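(* Let $d\ge 2$, $1\le k<d$ and $n_1,\dots,n_d\ge 1$ be integers and put $N=\binom{d}{k}$. Let $A\in\mathbb{R}^{n_1\times\cdots\times n_d}$ be a tensor with nonnegative entries, and let $S=\{S_{s,i} : 1\le i\le N,\ 1\le s\le |(i)|\}$ be a family of strictly positive real numbers. With the notation defined in the context: There exists at most one tensor $A'\in\mathbb{R}^{n_1\times\cdots\times n_d}$ for which there exist $N$ scaling lists $M_{(i)}=\{M_{s,i} : 1\le s\le|(i)|\}$, $1\le i\le N$, of positive real numbers such that $(A',\{M_{(i)} : 1\le i\le N\})$ satisfies Program I. Furthermore, if $(A',\{M^1_{(i)} : 1\le i\le N\})$ satisfies Program I, then the general solution of Program I is $$\left(A',\ \{MT^1_{(i)} : 1\le i\le N\}\right),\qquad MT^1_{(i)}=\{M^1_{s,i}T_{s,i} : 1\le s\le|(i)|\},$$ where $T_{(i)}=\{T_{s,i}\in\mathbb{R}_{>0} : 1\le s\le|(i)|\}$, $1\le i\le N$, ranges over all families of $N$ lists of positive reals such that $$\prod_{(s,i)\in\sigma_A(\vec\alpha)}T_{s,i}=1\qquad\text{for all }\vec\alpha\in\sigma(A);$$ that is, the pairs satisfying Program I are exactly the pairs of this form.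
   Context: Positions of a tensor $A\in\mathbb{R}^{n_1\times\cdots\times n_d}$ are the multi-indices $\vec\alpha=(\alpha_1,\dots,\alpha_d)$ with $1\le\alpha_j\le n_j$; the entry there is $A(\vec\alpha)$. **Sets of subtensors.** Enumerate the $k$-element subsets of $\{1,\dots,d\}$ as $I_1,\dots,I_N$, $N=\binom{d}{k}$. For each $i$, the set $(i)$ consists of all $k$-dimensional subtensors of $A$ in the directions $I_i$, i.e. those obtained by fixing the coordinates $\alpha_j$ for $j\notin I_i$ and letting the coordinates $\alpha_j$, $j\in I_i$, vary. There are $|(i)|=\prod_{j\notin I_i}n_j$ of them; they are labelled $A_{s,i}$, $1\le s\le |(i)|$, and they partition the positions of the tensor. The same labelling is used for all tensors of the same shape. Each position $\vec\alpha$ thus lies in exactly one subtensor $A_{s_i,i}$ of each set $(i)$; write $$\sigma_A(\vec\alpha)=\{(s_1,1),\dots,(s_N,N)\}$$ for the set of labels of the subtensors containing position $\vec\alpha$. **Supports.** $\sigma_A(s,i)=\{\vec\alpha : (s,i)\in\sigma_A(\vec\alpha),\ A(\vec\alpha)\ne 0\}$ is the support of the subtensor $A_{s,i}$, and $\sigma(A)=\bigcup_{(s,i)}\sigma_A(s,i)=\{\vec\alpha : A(\vec\alpha)\neq 0\}$. **Program I.** A pair $(A',\{M_{(i)}\}_{1\le i\le N})$, with $A'\in\mathbb{R}^{n_1\times\cdots\times n_d}$ and lists $M_{(i)}=\{M_{s,i} : 1\le s\le|(i)|\}$ of positive reals, satisfies Program I if $$A'(\vec\alpha)=A(\vec\alpha)\prod_{(s,i)\in\sigma_A(\vec\alpha)}M_{s,i}\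 \text{ if }\vec\alpha\in\sigma(A),\qquad A'(\vec\alpha)=0\ \text{ otherwise},$$ and $$\prod_{\vec\alpha\in\sigma_A(s,i)}A'(\vec\alpha)=S_{s,i}\quad\text{for every pair }(s,i),\ 1\le i\le N,\ 1\le s\le|(i)|,$$ where empty products equal $1$. (Program I is equivalently phrased additively by taking logarithms: $m_{s,i}=\ln M_{s,i}$, $s_{s,i}=\ln S_{s,i}$, $a(\vec\alpha)=\ln A(\vec\alpha)$ and $a'(\vec\alpha)=\ln A'(\vec\alpha)$ on $\sigma(A)$, and $a=a'=0$ off $\sigma(A)$.) *)

theory Defs
  imports "HOL-Analysis.Analysis"
begin

text \<open>
  The shape of a tensor is given by its order \<open>d\<close> and \<open>n :: nat \<Rightarrow> nat\<close>, of which only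
  \<open>n 1, \<dots>, n d\<close> matter. Multi-indices, tensors and scaling families are extensional functions
  (\<open>undefined\<close> outside their domain), so that equality of two tensors, or of two families of
  scaling lists, is equality of their entries.
\<close>

definition positions :: "nat \<Rightarrow> (nat \<Rightarrow> nat) \<Rightarrow> (nat \<Rightarrow> nat) set" where
  "positions d n = (\<Pi>\<^sub>E j\<in>{1..d}. {1..n j})"

definition tensors :: "nat \<Rightarrow> (nat \<Rightarrow> nat) \<Rightarrow> ((nat \<Rightarrow> nat) \<Rightarrow> real) set" where
  "tensors d n = positions d n \<rightarrow>\<^sub>E UNIV"

text \<open>
  A subtensor in the directions \<open>J\<close> is represented by the set of positions it occupies. This
  depends on the shape only, so one labelling serves all tensors of that shape.
\<close>

definition subtensor :: "nat \<Rightarrow> (nat \<Rightarrow> nat) \<Rightarrow> nat set \<Rightarrow> (nat \<Rightarrow> nat) \<Rightarrow> (nat \<Rightarrow> nat) set" where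
  "subtensor d n J \<alpha> = {\<beta> \<in> positions d n. \<forall>j\<in>{1..d} - J. \<beta> j = \<alpha> j}"

definition subtensors :: "nat \<Rightarrow> (nat \<Rightarrow> nat) \<Rightarrow> nat set \<Rightarrow> (nat \<Rightarrow> nat) set set" where
  "subtensors d n J = subtensor d n J ` positions d n"

text \<open>
  \<open>I i\<close> is the \<open>i\<close>-th \<open>k\<close>-element set of directions and \<open>P s i\<close> is the set of positions of the
  subtensor with label \<open>(s, i)\<close>.
\<close>

definition subtensor_labelling ::
    "nat \<Rightarrow> nat \<Rightarrow> (nat \<Rightarrow> nat) \<Rightarrow> (nat \<Rightarrow> nat set) \<Rightarrow> (nat \<Rightarrow> nat \<Rightarrow> (nat \<Rightarrow> nat) set) \<Rightarrow> bool" where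
  "subtensor_labelling d k n I P \<longleftrightarrow>
     bij_betw I {1..d choose k} {J. J \<subseteq> {1..d} \<and> card J = k} \<and>
     (\<forall>i\<in>{1..d choose k}.
        bij_betw (\<lambda>s. P s i) {1..card (subtensors d n (I i))} (subtensors d n (I i)))"

definition labels :: "nat \<Rightarrow> nat \<Rightarrow> (nat \<Rightarrow> nat) \<Rightarrow> (nat \<Rightarrow> nat set) \<Rightarrow> (nat \<times> nat) set" where
  "labels d k n I =
     {(s, i). i \<in> {1..d choose k} \<and> s \<in> {1..card (subtensors d n (I i))}}"

text \<open>\<open>labels_at\<close> is $\sigma_A(\vec\alpha)$; it depends on \<open>A\<close> only through its shape.\<close>

definition labels_at ::
    "nat \<Rightarrow> nat \<Rightarrow> (nat \<Rightarrow> nat) \<Rightarrow> (nat \<Rightarrow> nat set) \<Rightarrow> (nat \<Rightarrow> nat \<Rightarrow> (nat \<Rightarrow> nat) set) \<Rightarrow>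
     (nat \<Rightarrow> nat) \<Rightarrow> (nat \<times> nat) set" where
  "labels_at d k n I P \<alpha> = {(s, i) \<in> labels d k n I. \<alpha> \<in> P s i}"

definition subtensor_support ::
    "nat \<Rightarrow> nat \<Rightarrow> (nat \<Rightarrow> nat) \<Rightarrow> (nat \<Rightarrow> nat set) \<Rightarrow> (nat \<Rightarrow> nat \<Rightarrow> (nat \<Rightarrow> nat) set) \<Rightarrow>
     ((nat \<Rightarrow> nat) \<Rightarrow> real) \<Rightarrow> nat \<times> nat \<Rightarrow> (nat \<Rightarrow> nat) set" where
  "subtensor_support d k n I P A l =
     {\<alpha> \<in> positions d n. l \<in> labels_at d k n I P \<alpha> \<and> A \<alpha> \<noteq> 0}"

definition tensor_support ::
    "nat \<Rightarrow> nat \<Rightarrow> (nat \<Rightarrow> nat) \<Rightarrow> (nat \<Rightarrow> nat set) \<Rightarrow> (nat \<Rightarrow> nat \<Rightarrow> (nat \<Rightarrow> nat) set) \<Rightarrow>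
     ((nat \<Rightarrow> nat) \<Rightarrow> real) \<Rightarrow> (nat \<Rightarrow> nat) set" where
  "tensor_support d k n I P A = (\<Union>l\<in>labels d k n I. subtensor_support d k n I P A l)"

text \<open>
  The \<open>N = d choose k\<close> lists of positive reals, as one function: entry \<open>s\<close> of the \<open>i\<close>-th list
  is the value at \<open>(s, i)\<close>.
\<close>

definition positive_families ::
    "nat \<Rightarrow> nat \<Rightarrow> (nat \<Rightarrow> nat) \<Rightarrow> (nat \<Rightarrow> nat set) \<Rightarrow> (nat \<times> nat \<Rightarrow> real) set" where
  "positive_families d k n I = labels d k n I \<rightarrow>\<^sub>E {0<..}"

definition program_I ::
    "nat \<Rightarrow> nat \<Rightarrow> (nat \<Rightarrow> nat) \<Rightarrow> (nat \<Rightarrow> nat set) \<Rightarrow> (nat \<Rightarrow> nat \<Rightarrow> (nat \<Rightarrow> nat) set) \<Rightarrow>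
     ((nat \<Rightarrow> nat) \<Rightarrow> real) \<Rightarrow> (nat \<times> nat \<Rightarrow> real) \<Rightarrow>
     ((nat \<Rightarrow> nat) \<Rightarrow> real) \<Rightarrow> (nat \<times> nat \<Rightarrow> real) \<Rightarrow> bool" where
  "program_I d k n I P A S A' M \<longleftrightarrow>
     A' \<in> tensors d n \<and> M \<in> positive_families d k n I \<and>
     (\<forall>\<alpha>\<in>positions d n.
        A' \<alpha> = (if \<alpha> \<in> tensor_support d k n I P A
                then A \<alpha> * (\<Prod>l\<in>labels_at d k n I P \<alpha>. M l) else 0)) \<and>
     (\<forall>l\<in>labels d k n I. (\<Prod>\<alpha>\<in>subtensor_support d k n I P A l. A' \<alpha>) = S l)"

lemma finite_positions [simp]: "finite (positions d n)"
  unfolding positions_def by (intro finite_PiE) auto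

lemma finite_subtensors [simp]: "finite (subtensors d n J)"
  unfolding subtensors_def by simp

lemma finite_labels [simp]: "finite (labels d k n I)"
proof -
  have "labels d k n I \<subseteq> (\<Union>i\<in>{1..d choose k}. {1..card (subtensors d n (I i))} \<times> {i})"
    by (auto simp: labels_def)
  then show ?thesis
    by (rule finite_subset) auto
qed

lemma subtensor_labelling_exists: "\<exists>I P. subtensor_labelling d k n I P"
proof -
  have bij: "\<exists>h. bij_betw h {1..card X} X" if "finite X" for X :: "'b set"
    using that by (rule ex_bij_betw_nat_finite_1)
  have "card {J. J \<subseteq> {1..d} \<and> card J = k} = d choose k"
    using n_subsets[of "{1..d}" k] by simp
  moreover have "finite {J. J \<subseteq> {1..d} \<and> card J = k}"
    by (rule finite_subset[of _ "Pow {1..d}"]) auto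
  ultimately obtain I where I: "bij_betw I {1..d choose k} {J. J \<subseteq> {1..d} \<and> card J = k}"
    using bij by metis
  have "\<forall>i. \<exists>h. bij_betw h {1..card (subtensors d n (I i))} (subtensors d n (I i))"
    by (intro allI bij finite_subtensors)
  then obtain Q where "\<And>i. bij_betw (Q i) {1..card (subtensors d n (I i))} (subtensors d n (I i))"
    by metis
  with I have "subtensor_labelling d k n I (\<lambda>s i. Q i s)"
    by (auto simp: subtensor_labelling_def)
  then show ?thesis by blast
qed

lemma card_subtensors:
  assumes "J \<subseteq> {1..d}" and "\<forall>j\<in>{1..d}. 1 \<le> n j"
  shows "card (subtensors d n J) = (\<Prod>j\<in>{1..d} - J. n j)"
proof -
  let ?K = "{1..d} - J"
  let ?F = "\<Pi>\<^sub>E j\<in>?K. {1..n j}"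
  let ?S = "\<lambda>\<beta>. {\<gamma> \<in> positions d n. \<forall>j\<in>?K. \<gamma> j = \<beta> j}"
  let ?ext = "\<lambda>\<beta>. \<lambda>j\<in>{1..d}. if j \<in> J then 1 else \<beta> j"
  have ext: "?ext \<beta> \<in> positions d n" if "\<beta> \<in> ?F" for \<beta>
    using that assms by (auto simp: positions_def PiE_iff)
  have "inj_on ?S ?F"
  proof (rule inj_onI)
    fix \<beta> \<gamma> assume \<beta>: "\<beta> \<in> ?F" and \<gamma>: "\<gamma> \<in> ?F" and eq: "?S \<beta> = ?S \<gamma>"
    have "?ext \<beta> \<in> ?S \<beta>" using ext[OF \<beta>] by auto
    then have "?ext \<beta> \<in> ?S \<gamma>" using eq by blast
    then have "\<forall>j\<in>?K. \<beta> j = \<gamma> j" by auto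
    then show "\<beta> = \<gamma>" using \<beta> \<gamma> by (intro PiE_ext[OF \<beta> \<gamma>]) auto
  qed
  moreover have "subtensors d n J = ?S ` ?F"
  proof (intro equalityI subsetI)
    fix X assume "X \<in> subtensors d n J"
    then obtain \<alpha> where \<alpha>: "\<alpha> \<in> positions d n" "X = subtensor d n J \<alpha>"
      by (auto simp: subtensors_def)
    then have "X = ?S (restrict \<alpha> ?K)" "restrict \<alpha> ?K \<in> ?F"
      by (auto simp: subtensor_def positions_def PiE_iff)
    then show "X \<in> ?S ` ?F" by blast
  next
    fix X assume "X \<in> ?S ` ?F"
    then obtain \<beta> where \<beta>: "\<beta> \<in> ?F" "X = ?S \<beta>" by blast
    then have "X = subtensor d n J (?ext \<beta>)"
      by (auto simp: subtensor_def)
    then show "X \<in> subtensors d n J"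
      using ext[OF \<beta>(1)] by (auto simp: subtensors_def)
  qed
  ultimately have "card (subtensors d n J) = card ?F"
    by (simp add: card_image)
  also have "\<dots> = (\<Prod>j\<in>?K. n j)"
    by (simp add: card_PiE)
  finally show ?thesis .
qed

lemma ex1_subtensor:
  assumes "subtensor_labelling d k n I P" "\<alpha> \<in> positions d n" "i \<in> {1..d choose k}"
  shows "\<exists>!s. (s, i) \<in> labels_at d k n I P \<alpha>"
proof -
  let ?D = "{1..card (subtensors d n (I i))}"
  have bij: "bij_betw (\<lambda>s. P s i) ?D (subtensors d n (I i))"
    using assms by (auto simp: subtensor_labelling_def)
  have "\<exists>!X. X \<in> subtensors d n (I i) \<and> \<alpha> \<in> X"
    using assms(2) by (intro ex1I[of _ "subtensor d n (I i) \<alpha>"])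
      (auto simp: subtensors_def subtensor_def)
  then obtain X where X: "X \<in> subtensors d n (I i)" "\<alpha> \<in> X"
    "\<And>Y. Y \<in> subtensors d n (I i) \<Longrightarrow> \<alpha> \<in> Y \<Longrightarrow> Y = X" by blast
  have img: "(\<lambda>s. P s i) ` ?D = subtensors d n (I i)"
    using bij by (rule bij_betw_imp_surj_on)
  have "X \<in> (\<lambda>s. P s i) ` ?D"
    using X(1) img by simp
  then obtain s where s: "s \<in> ?D" "P s i = X"
    by blast
  show ?thesis
  proof (rule ex1I[of _ s])
    show "(s, i) \<in> labels_at d k n I P \<alpha>"
      using s X(2) assms(3) by (auto simp: labels_at_def labels_def)
  next
    fix t assume "(t, i) \<in> labels_at d k n I P \<alpha>"
    then have t: "t \<in> ?D" "\<alpha> \<in> P t i" by (auto simp: labels_at_def labels_def)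
    have "P t i \<in> subtensors d n (I i)"
      using t(1) img by blast
    then have "P t i = P s i"
      using X(3)[OF _ t(2)] s(2) by simp
    then show "t = s"
      using bij_betw_imp_inj_on[OF bij] t(1) s(1) by (auto dest: inj_onD)
  qed
qed

lemma tensor_support_eq:
  assumes "subtensor_labelling d k n I P" "k \<le> d"
  shows "tensor_support d k n I P A = {\<alpha> \<in> positions d n. A \<alpha> \<noteq> 0}"
proof -
  have "0 < d choose k"
    using assms(2) by simp
  then have "1 \<in> {1..d choose k}" by (simp only: atLeastAtMost_iff) linarith
  then have "\<exists>l. l \<in> labels_at d k n I P \<alpha>" if "\<alpha> \<in> positions d n" for \<alpha>
    using ex1_subtensor[OF assms(1) that] by blast
  moreover have "labels_at d k n I P \<alpha> \<subseteq> labels d k n I" for \<alpha>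
    by (auto simp: labels_at_def)
  ultimately show ?thesis
    by (fastforce simp: tensor_support_def subtensor_support_def)
qed

end

theory Submission
  imports Defs
begin

text \<open>
  Two solutions differ by a family of multipliers \<open>T\<close>; put \<open>t = ln T\<close>. The logarithm of the ratio
  of the two tensors at a position \<open>\<alpha>\<close> of the support is \<open>x \<alpha> = (\<Sum>l\<in>R \<alpha>. t l)\<close>, where \<open>R \<alpha>\<close> is
  the set of labels at \<open>\<alpha>\<close>, so \<open>x\<close> is a combination of indicators of the subtensor supports. The
  product conditions say that \<open>x\<close> is orthogonal to each of these indicators. Hence \<open>x\<close> is orthogonal
  to itself and vanishes.
\<close>

text \<open>With \<open>C\<close> the 0-1 matrix whose entry at \<open>(l, \<alpha>)\<close> tells
  whether \<open>l\<close> lies in \<open>R \<alpha>\<close>, this is the fact that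
  \<open>C C^T t = 0\<close> forces \<open>C^T t = 0\<close>, since the squared norm of
  \<open>C^T t\<close> is the inner product of \<open>t\<close> with \<open>C C^T t\<close>.\<close>

lemma sum_incidence_eq_0:
  fixes t :: "'l \<Rightarrow> real" and R :: "'v \<Rightarrow> 'l set"
  assumes "finite V" "finite L" "\<And>\<alpha>. \<alpha> \<in> V \<Longrightarrow> R \<alpha> \<subseteq> L"
    and orth: "\<And>l. l \<in> L \<Longrightarrow> (\<Sum>\<alpha> | \<alpha> \<in> V \<and> l \<in> R \<alpha>. \<Sum>l'\<in>R \<alpha>. t l') = 0"
    and "\<alpha> \<in> V"
  shows "(\<Sum>l\<in>R \<alpha>. t l) = 0"
proof -
  define x where "x \<alpha> = (\<Sum>l\<in>R \<alpha>. t l)" for \<alpha>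
  \<comment> \<open>One factor \<open>x \<alpha>\<close> is expanded. Its index set
    \<open>R \<alpha>\<close> is written as a filter of \<open>L\<close>, so that exchanging the
    sums turns it into a filter of \<open>V\<close>, as in \<open>orth\<close>.\<close>
  have "(\<Sum>\<alpha>\<in>V. (x \<alpha>)\<^sup>2) = (\<Sum>\<alpha>\<in>V. \<Sum>l | l \<in> L \<and> l \<in> R \<alpha>. t l * x \<alpha>)"
  proof (rule sum.cong[OF refl])
    fix \<alpha> assume "\<alpha> \<in> V"
    then have "{l. l \<in> L \<and> l \<in> R \<alpha>} = R \<alpha>"
      using assms(3) by blast
    then show "(x \<alpha>)\<^sup>2 = (\<Sum>l | l \<in> L \<and> l \<in> R \<alpha>. t l * x \<alpha>)"
      by (simp add: power2_eq_square sum_distrib_right[symmetric] x_def)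
  qed
  also have "\<dots> = (\<Sum>l\<in>L. \<Sum>\<alpha> | \<alpha> \<in> V \<and> l \<in> R \<alpha>. t l * x \<alpha>)"
    by (rule sum.swap_restrict) (use assms in auto)
  also have "\<dots> = 0"
    using orth by (simp add: sum_distrib_left[symmetric] x_def)
  finally show ?thesis
    using assms(1,5) by (simp add: sum_nonneg_eq_0_iff x_def)
qed

text \<open>The multiplicative form of the preceding lemma, with \<open>t = ln T\<close>; positivity
  of \<open>T\<close> on \<open>L\<close> makes \<open>exp\<close> undo \<open>ln\<close>.\<close>

lemma prod_incidence_eq_1:
  fixes T :: "'l \<Rightarrow> real" and R :: "'v \<Rightarrow> 'l set"
  assumes "finite V" "finite L" and R: "\<And>\<alpha>. \<alpha> \<in> V \<Longrightarrow> R \<alpha> \<subseteq> L"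
    and pos: "\<And>l. l \<in> L \<Longrightarrow> 0 < T l"
    and prod1: "\<And>l. l \<in> L \<Longrightarrow> (\<Prod>\<alpha> | \<alpha> \<in> V \<and> l \<in> R \<alpha>. \<Prod>l'\<in>R \<alpha>. T l') = 1"
    and "\<alpha> \<in> V"
  shows "(\<Prod>l\<in>R \<alpha>. T l) = 1"
proof -
  have prod_eq_exp: "(\<Prod>l\<in>R \<beta>. T l) = exp (\<Sum>l\<in>R \<beta>. ln (T l))" if "\<beta> \<in> V" for \<beta>
  proof -
    have "finite (R \<beta>)"
      using R[OF that] assms(2) by (rule finite_subset)
    moreover have "exp (ln (T l)) = T l" if "l \<in> R \<beta>" for l
      using pos R \<open>\<beta> \<in> V\<close> that by force
    ultimately show ?thesis
      by (simp add: exp_sum cong: prod.cong)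
  qed
  have "(\<Sum>\<beta> | \<beta> \<in> V \<and> l \<in> R \<beta>. \<Sum>l'\<in>R \<beta>. ln (T l')) = 0" if "l \<in> L" for l
  proof -
    have "exp (\<Sum>\<beta> | \<beta> \<in> V \<and> l \<in> R \<beta>. \<Sum>l'\<in>R \<beta>. ln (T l'))
        = (\<Prod>\<beta> | \<beta> \<in> V \<and> l \<in> R \<beta>. exp (\<Sum>l'\<in>R \<beta>. ln (T l')))"
      using assms(1) by (intro exp_sum) auto
    also have "\<dots> = (\<Prod>\<beta> | \<beta> \<in> V \<and> l \<in> R \<beta>. \<Prod>l'\<in>R \<beta>. T l')"
      by (rule prod.cong[OF refl], rule prod_eq_exp[symmetric]) auto
    finally have "exp (\<Sum>\<beta> | \<beta> \<in> V \<and> l \<in> R \<beta>. \<Sum>l'\<in>R \<beta>. ln (T l')) = 1"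
      using prod1[OF that] by simp
    then show ?thesis
      by simp
  qed
  then have "(\<Sum>l\<in>R \<alpha>. ln (T l)) = 0"
    using assms(1,2,6) R sum_incidence_eq_0[of V L R "\<lambda>l. ln (T l)"] by blast
  then show ?thesis
    using prod_eq_exp assms(6) by simp
qed

lemma labels_at_subset: "labels_at d k n I P \<alpha> \<subseteq> labels d k n I"
  by (auto simp: labels_at_def)

lemma tensor_support_subset: "tensor_support d k n I P A \<subseteq> positions d n"
  by (auto simp: tensor_support_def subtensor_support_def)

text \<open>Gives the supports the shape of the index sets in
  \<open>prod_incidence_eq_1\<close>.\<close>

lemma subtensor_support_conv:
  assumes "l \<in> labels d k n I"
  shows "subtensor_support d k n I P A l =
    {\<alpha>. \<alpha> \<in> tensor_support d k n I P A \<and> l \<in> labels_at d k n I P \<alpha>}"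
  using assms by (auto simp: tensor_support_def subtensor_support_def)

lemma positive_families_scaled:
  assumes "M1 \<in> positive_families d k n I" "T \<in> positive_families d k n I"
  shows "(\<lambda>l\<in>labels d k n I. M1 l * T l) \<in> positive_families d k n I"
  using assms by (auto simp: positive_families_def PiE_iff)

text \<open>Carries both claims of the theorem: \<open>B\<close> is arbitrary, and every positive
  family is \<open>M1\<close> times some \<open>T\<close>, so the equivalence decides every
  candidate pair.\<close>

lemma program_I_scaled_iff:
  assumes S: "\<forall>l\<in>labels d k n I. 0 < S l"
    and A': "program_I d k n I P A S A' M1"
    and T: "T \<in> positive_families d k n I"
  shows "program_I d k n I P A S B (\<lambda>l\<in>labels d k n I. M1 l * T l) \<longleftrightarrow>
    B = A' \<and> (\<forall>\<alpha>\<in>tensor_support d k n I P A. (\<Prod>l\<in>labels_at d k n I P \<alpha>. T l) = 1)"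
    (is "program_I _ _ _ _ _ _ _ _ ?M \<longleftrightarrow> _")
proof -
  define V where "V = tensor_support d k n I P A"
  define L where "L = labels d k n I"
  define R where "R = labels_at d k n I P"
  have program: "program_I d k n I P A S B M \<longleftrightarrow>
      B \<in> tensors d n \<and> M \<in> positive_families d k n I \<and>
      (\<forall>\<alpha>\<in>positions d n. B \<alpha> = (if \<alpha> \<in> V then A \<alpha> * prod M (R \<alpha>) else 0)) \<and>
      (\<forall>l\<in>L. prod B (subtensor_support d k n I P A l) = S l)" for B M
    by (simp only: program_I_def V_def L_def R_def)
  from A' have A'_tensor: "A' \<in> tensors d n" and M1: "M1 \<in> positive_families d k n I"
    and A'_val: "\<And>\<alpha>. \<alpha> \<in> positions d n \<Longrightarrow> A' \<alpha> = (if \<alpha> \<in> V then A \<alpha> * prod M1 (R \<alpha>) else 0)"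
    and A'_prod: "\<And>l. l \<in> L \<Longrightarrow> prod A' (subtensor_support d k n I P A l) = S l"
    unfolding program by blast+
  have scaled: "(\<Prod>l\<in>R \<alpha>. ?M l) = (\<Prod>l\<in>R \<alpha>. M1 l) * (\<Prod>l\<in>R \<alpha>. T l)" for \<alpha>
    unfolding prod.distrib[symmetric] R_def
    by (rule prod.cong) (auto dest: labels_at_subset[THEN subsetD])
  have VP: "V \<subseteq> positions d n"
    unfolding V_def by (rule tensor_support_subset)
  show ?thesis
    unfolding V_def[symmetric] R_def[symmetric]
  proof
    assume "program_I d k n I P A S B ?M"
    then have B_tensor: "B \<in> tensors d n"
      and B_val: "\<And>\<alpha>. \<alpha> \<in> positions d n \<Longrightarrow> B \<alpha> = (if \<alpha> \<in> V then A \<alpha> * prod ?M (R \<alpha>) else 0)"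
      and B_prod: "\<And>l. l \<in> L \<Longrightarrow> prod B (subtensor_support d k n I P A l) = S l"
      unfolding program by blast+
    \<comment> \<open>This holds off \<open>V\<close> as well, where both tensors are 0.\<close>
    have ratio: "B \<alpha> = A' \<alpha> * (\<Prod>l\<in>R \<alpha>. T l)" if "\<alpha> \<in> positions d n" for \<alpha>
      unfolding A'_val[OF that] B_val[OF that] scaled by simp
    have "(\<Prod>l\<in>R \<alpha>. T l) = 1" if "\<alpha> \<in> V" for \<alpha>
    proof (rule prod_incidence_eq_1[OF _ _ _ _ _ that])
      show "finite V"
        using VP by (rule finite_subset) simp
      show "finite L" by (simp add: L_def)
      show "R \<beta> \<subseteq> L" for \<beta>
        unfolding R_def L_def by (rule labels_at_subset)
      show "0 < T l" if "l \<in> L" for l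
        using T that by (auto simp: positive_families_def L_def)
      fix l assume l: "l \<in> L"
      let ?U = "{\<alpha>. \<alpha> \<in> V \<and> l \<in> R \<alpha>}"
      have supp: "subtensor_support d k n I P A l = ?U"
        using l unfolding V_def R_def L_def by (rule subtensor_support_conv)
      \<comment> \<open>The products of \<open>B\<close> and of \<open>A'\<close> over
        \<open>?U\<close> both equal \<open>S l\<close> and differ by the factor in question;
        \<open>S l\<close> is positive and can be cancelled.\<close>
      have "S l = (\<Prod>\<alpha>\<in>?U. B \<alpha>)"
        using B_prod[OF l] supp by simp
      also have "\<dots> = (\<Prod>\<alpha>\<in>?U. A' \<alpha>) * (\<Prod>\<alpha>\<in>?U. \<Prod>l\<in>R \<alpha>. T l)"
        unfolding prod.distrib[symmetric] by (rule prod.cong) (use ratio VP in auto)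
      also have "(\<Prod>\<alpha>\<in>?U. A' \<alpha>) = S l"
        using A'_prod[OF l] supp by simp
      finally show "(\<Prod>\<alpha>\<in>?U. \<Prod>l\<in>R \<alpha>. T l) = 1"
        using S[rule_format, of l] l by (metis L_def less_irrefl mult_cancel_left1)
    qed
    \<comment> \<open>On \<open>V\<close> the ratio is now 1, and off \<open>V\<close> both values
      are 0. Tensors are extensional, so agreement on all positions gives equality of
      functions.\<close>
    moreover from this have "B \<alpha> = A' \<alpha>" if "\<alpha> \<in> positions d n" for \<alpha>
      using ratio[OF that] A'_val[OF that] that by (cases "\<alpha> \<in> V") auto
    then have "B = A'"
      using B_tensor A'_tensor unfolding tensors_def by (intro PiE_ext)
    ultimately show "B = A' \<and> (\<forall>\<alpha>\<in>V. (\<Prod>l\<in>R \<alpha>. T l) = 1)"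
      by blast
  next
    assume "B = A' \<and> (\<forall>\<alpha>\<in>V. (\<Prod>l\<in>R \<alpha>. T l) = 1)"
    moreover have "?M \<in> positive_families d k n I"
      using M1 T by (rule positive_families_scaled)
    ultimately show "program_I d k n I P A S B ?M"
      \<comment> \<open>The extra factor is 1 on \<open>V\<close>, and the conditions involving
        \<open>S\<close> do not mention the scaling family, so they carry over from
        \<open>A'\<close>.\<close>
      unfolding program scaled using A'_tensor A'_val A'_prod by simp
  qed
qed

text \<open>The witness is the entrywise quotient. Families are \<open>undefined\<close> outside the
  labels, so the restricted product equals \<open>M\<close> as a function.\<close>

lemma positive_families_factor:
  assumes "M1 \<in> positive_families d k n I" "M \<in> positive_families d k n I"
  obtains T where "T \<in> positive_families d k n I" "M = (\<lambda>l\<in>labels d k n I. M1 l * T l)"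
proof
  show "(\<lambda>l\<in>labels d k n I. M l / M1 l) \<in> positive_families d k n I"
    using assms by (auto simp: positive_families_def PiE_iff)
  have "M1 l \<noteq> 0" if "l \<in> labels d k n I" for l
    using PiE_mem[OF assms(1)[unfolded positive_families_def] that] by simp
  then show "M = (\<lambda>l\<in>labels d k n I. M1 l * (\<lambda>l\<in>labels d k n I. M l / M1 l) l)"
    using assms(2) by (auto simp: positive_families_def PiE_def extensional_def)
qed

theorem theorem3p2:
  fixes d k :: nat and n :: "nat \<Rightarrow> nat"
    and I :: "nat \<Rightarrow> nat set" and P :: "nat \<Rightarrow> nat \<Rightarrow> (nat \<Rightarrow> nat) set"
    and A :: "(nat \<Rightarrow> nat) \<Rightarrow> real" and S :: "nat \<times> nat \<Rightarrow> real"
  assumes "2 \<le> d" and "1 \<le> k" and "k < d"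
    and "\<forall>j\<in>{1..d}. 1 \<le> n j"
    and "subtensor_labelling d k n I P"
    and "A \<in> tensors d n" and "\<forall>\<alpha>\<in>positions d n. 0 \<le> A \<alpha>"
    and "\<forall>l\<in>labels d k n I. 0 < S l"
  shows "(\<exists>\<^sub>\<le>\<^sub>1 A'. \<exists>M. program_I d k n I P A S A' M) \<and>
    (\<forall>A' M1. program_I d k n I P A S A' M1 \<longrightarrow>
      {(B, M). program_I d k n I P A S B M} =
      {(A', \<lambda>l\<in>labels d k n I. M1 l * T l) | T.
         T \<in> positive_families d k n I \<and>
         (\<forall>\<alpha>\<in>tensor_support d k n I P A. (\<Prod>l\<in>labels_at d k n I P \<alpha>. T l) = 1)})"
proof -
  note scaled = program_I_scaled_iff[OF assms(8)]
  have fam: "M \<in> positive_families d k n I" if "program_I d k n I P A S B M" for B M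
    using that by (simp add: program_I_def)
  have factor: "\<exists>T. T \<in> positive_families d k n I \<and> M = (\<lambda>l\<in>labels d k n I. M1 l * T l)"
    if "program_I d k n I P A S A' M1" "program_I d k n I P A S B M" for A' M1 B M
    using positive_families_factor[OF fam[OF that(1)] fam[OF that(2)]] by metis
  \<comment> \<open>The second solution is rewritten as a rescaling of \<open>M1\<close>; the
    forward direction of \<open>scaled\<close> then identifies the tensors.\<close>
  have unique: "B = A'"
    if "program_I d k n I P A S A' M1" "program_I d k n I P A S B M" for A' M1 B M
    using factor[OF that] scaled[OF that(1)] that(2) by blast
  have "{(B, M). program_I d k n I P A S B M} =
      {(A', \<lambda>l\<in>labels d k n I. M1 l * T l) | T.
         T \<in> positive_families d k n I \<and>
         (\<forall>\<alpha>\<in>tensor_support d k n I P A. (\<Prod>l\<in>labels_at d k n I P \<alpha>. T l) = 1)}"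
    (is "?X = ?Y") if A': "program_I d k n I P A S A' M1" for A' M1
  proof (intro equalityI subsetI)
    fix p assume "p \<in> ?X"
    then obtain B M where p: "p = (B, M)" and BM: "program_I d k n I P A S B M"
      by blast
    from factor[OF A' BM] obtain T where T: "T \<in> positive_families d k n I"
      and M: "M = (\<lambda>l\<in>labels d k n I. M1 l * T l)"
      by blast
    show "p \<in> ?Y"
      using BM scaled[OF A' T] T unfolding p M by blast
  next
    fix p assume "p \<in> ?Y"
    then show "p \<in> ?X"
      using scaled[OF A'] by blast
  qed
  then show ?thesis
    using unique by (auto simp: Uniq_def)
qed

end
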